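(* Let $a,b,J$ be positive integers with $J\ge 3$. If $H(a,J) \geq aJ+1$, then $$H(a+b,J) \leq H(a,J) + H(b,J) - \left\lceil\frac{H(a,J) -aJ}{aJ-1}\right\rceil$$ and $$H(2a,J) \leq 2H(a,J) - 2\left\lceil\frac{H(a,J) -aJ}{aJ-1}\right\rceil.$$
   Context: A Golomb ruler is a set $\{a_1,\dots,a_k\}$ of $k$ distinct non-negative integers such that all the differences $a_i-a_j$, $i\neq j$, are distinct. An $(I,J,n)$-DGR is a set of $I$ pairwise disjoint Golomb rulers, each being a $J$-element subset of $\{1,2,\dots,n\}$. For positive integers $I,J$, $H(I,J)$ is the least positive integer $n$ such that there is an $(I,J,n)$-DGR. *)

theory Defs
  imports Complex_Main
begin

text \<open>
  Differences are signed and range over ordered pairs of distinct elements; they are taken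
  in \<^typ>\<open>int\<close> because subtraction on \<^typ>\<open>nat\<close> truncates.
\<close>
definition golomb_ruler :: "nat set \<Rightarrow> bool" where
  "golomb_ruler A \<longleftrightarrow>
     finite A \<and> inj_on (\<lambda>(x, y). int x - int y) {(x, y). x \<in> A \<and> y \<in> A \<and> x \<noteq> y}"

definition DGR :: "nat \<Rightarrow> nat \<Rightarrow> nat \<Rightarrow> nat set set \<Rightarrow> bool" where
  "DGR I J n \<R> \<longleftrightarrow>
     finite \<R> \<and> card \<R> = I \<and>
     (\<forall>A\<in>\<R>. golomb_ruler A \<and> A \<subseteq> {1..n} \<and> card A = J) \<and>
     (\<forall>A\<in>\<R>. \<forall>B\<in>\<R>. A \<noteq> B \<longrightarrow> A \<inter> B = {})"

definition H :: "nat \<Rightarrow> nat \<Rightarrow> nat" where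
  "H I J = (LEAST n. 0 < n \<and> (\<exists>\<R>. DGR I J n \<R>))"

text \<open>
  The set over which the minimum is taken is never empty for positive arguments, so the
  \<open>LEAST\<close> is attained: disjoint translates of \<open>{2 ^ 0, ..., 2 ^ (J - 1)}\<close> form a DGR.
\<close>

lemma pow2_sum_max:
  fixes x y z w :: nat
  assumes "x \<le> y" "z \<le> w" "(2::nat) ^ x + 2 ^ y = 2 ^ z + 2 ^ w"
  shows "y \<ge> w"
proof (rule ccontr)
  assume "\<not> y \<ge> w"
  then have "Suc y \<le> w" by simp
  then have "(2::nat) ^ Suc y \<le> 2 ^ w" by (intro power_increasing) auto
  moreover have "(2::nat) ^ x \<le> 2 ^ y" using assms(1) by (intro power_increasing) auto
  moreover have "(2::nat) ^ z > 0" by simp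
  ultimately show False using assms(3) by (simp del: zero_less_power)
qed

lemma pow2_sum_eq:
  fixes x y z w :: nat
  assumes "x \<le> y" "z \<le> w" "(2::nat) ^ x + 2 ^ y = 2 ^ z + 2 ^ w"
  shows "x = z \<and> y = w"
proof -
  have "y = w"
    using pow2_sum_max[OF assms] pow2_sum_max[OF assms(2,1) assms(3)[symmetric]] by simp
  then show ?thesis using assms(3) by simp
qed

lemma golomb_ruler_pow2: "golomb_ruler ((\<lambda>j. c + 2 ^ j) ` {..<J})" (is "golomb_ruler ?A")
proof -
  have key: "i = k \<and> j = l"
    if ne: "i \<noteq> j" and eq: "int (c + 2 ^ i) - int (c + 2 ^ j) = int (c + 2 ^ k) - int (c + 2 ^ l)"
    for i j k l :: nat
  proof -
    have "int (2 ^ i + 2 ^ l) = int (2 ^ k + 2 ^ j)" using eq by simp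
    then have "(2::nat) ^ i + 2 ^ l = 2 ^ k + 2 ^ j" by (simp only: of_nat_eq_iff)
    then have "min i l = min k j \<and> max i l = max k j"
      by (intro pow2_sum_eq) (auto simp: min_def max_def add.commute)
    then show ?thesis using ne by (auto simp: min_def max_def split: if_splits)
  qed
  have "p = q"
    if "p \<in> {(x, y). x \<in> ?A \<and> y \<in> ?A \<and> x \<noteq> y}" "q \<in> {(x, y). x \<in> ?A \<and> y \<in> ?A \<and> x \<noteq> y}"
      "(\<lambda>(x, y). int x - int y) p = (\<lambda>(x, y). int x - int y) q" for p q
  proof -
    from that obtain i j k l where p: "p = (c + 2 ^ i, c + 2 ^ j)" "c + 2 ^ i \<noteq> c + 2 ^ j"
      and q: "q = (c + 2 ^ k, c + 2 ^ l)"
      by blast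
    have "i \<noteq> j" using p(2) by blast
    moreover have "int (c + 2 ^ i) - int (c + 2 ^ j) = int (c + 2 ^ k) - int (c + 2 ^ l)"
      using that(3) unfolding p(1) q by (simp only: prod.case)
    ultimately show ?thesis using key p q by blast
  qed
  then show ?thesis
    unfolding golomb_ruler_def by (intro conjI inj_onI) simp_all
qed

lemma DGR_exists:
  assumes "0 < I" "0 < J"
  shows "\<exists>n>0. \<exists>\<R>. DGR I J n \<R>"
proof -
  define R where "R i = (\<lambda>j. i * 2 ^ J + 2 ^ j) ` {..<J}" for i :: nat
  have lt: "(2::nat) ^ j < 2 ^ J" if "j < J" for j
    using that by (intro power_strict_increasing) auto
  have div: "x div 2 ^ J = i" if "x \<in> R i" for x i
    using that lt by (auto simp: R_def)
  have ne: "R i \<noteq> {}" for i using assms(2) by (auto simp: R_def)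
  have inj: "inj_on R {..<I}"
    by (intro inj_onI) (metis div ne ex_in_conv)
  have disj: "R i \<inter> R k = {}" if "R i \<noteq> R k" for i k
    using that div by (metis disjoint_iff)
  have card: "card (R i) = J" for i
    unfolding R_def by (subst card_image) (auto simp: inj_on_def)
  have sub: "R i \<subseteq> {1..I * 2 ^ J}" if "i < I" for i
  proof
    fix x assume x: "x \<in> R i"
    then have "x > 0" by (auto simp: R_def)
    moreover have "x < I * 2 ^ J"
      using div[OF x] that by (metis div_less_iff_less_mult zero_less_numeral zero_less_power)
    ultimately show "x \<in> {1..I * 2 ^ J}" by simp
  qed
  have "DGR I J (I * 2 ^ J) (R ` {..<I})"
    unfolding DGR_def
  proof (intro conjI ballI impI)
    show "card (R ` {..<I}) = I" using inj by (simp add: card_image)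
    show "golomb_ruler A" if "A \<in> R ` {..<I}" for A
      using that golomb_ruler_pow2 by (auto simp: R_def)
    show "A \<subseteq> {1..I * 2 ^ J}" if "A \<in> R ` {..<I}" for A
      using that sub by (elim imageE) simp
    show "A \<inter> B = {}" if "A \<in> R ` {..<I}" "B \<in> R ` {..<I}" "A \<noteq> B" for A B
      using that disj by (elim imageE) simp
  qed (use card in auto)
  then show ?thesis using assms(1) by (intro exI[of _ "I * 2 ^ J"]) auto
qed

lemma H_attained:
  assumes "0 < I" "0 < J"
  shows "0 < H I J" "\<exists>\<R>. DGR I J (H I J) \<R>"
  using LeastI_ex[OF DGR_exists[OF assms]] by (simp_all only: H_def)

end

theory Submission
  imports Defs
begin

text \<open>
  Let \<open>n = H a J\<close> and let \<open>g\<close> be the rounded-up quotient. Minimality forces \<open>1\<close> and \<open>n\<close> to be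
  marks of an optimal DGR, so by pigeonhole some \<open>g\<close> consecutive numbers are free between two
  consecutive marks: the DGR splits into a left block of width \<open>p\<close>, the gap, and a right block
  of width \<open>q\<close>, and \<open>p \<le> q\<close> after a reflection. Moving two blocks of a ruler apart keeps it Golomb
  as soon as all differences across the blocks exceed all differences inside a block. Hence the
  following layouts, without spare room, are DGRs.
  For \<open>2 * a\<close>: two mirrored copies of the DGR are interleaved as left, left', right, right', with
  widths \<open>p, q, q, p\<close>.
  For \<open>a + b\<close> with \<open>m = H b J \<ge> q\<close>: the DGR of width \<open>m\<close> is inserted between the two blocks.
  For \<open>m < q\<close>: its top \<open>g\<close> numbers are moved into the gap and the remaining ones are
  placed to the right of \<open>n\<close>.
\<close>

section \<open>Golomb rulers under affine and piecewise shifts\<close>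

lemma golomb_rulerI:
  assumes "finite A"
    and "\<And>x y z w. \<lbrakk>x \<in> A; y \<in> A; z \<in> A; w \<in> A; x \<noteq> y; z \<noteq> w; int x - int y = int z - int w\<rbrakk>
      \<Longrightarrow> x = z \<and> y = w"
  shows "golomb_ruler A"
  using assms unfolding golomb_ruler_def inj_on_def by auto

lemma golomb_rulerD:
  assumes "golomb_ruler A" "x \<in> A" "y \<in> A" "z \<in> A" "w \<in> A" "x \<noteq> y"
    and "int x - int y = int z - int w"
  shows "x = z \<and> y = w"
proof -
  have "z \<noteq> w" using assms(6,7) by auto
  then have "(x, y) = (z, w)"
    using assms unfolding golomb_ruler_def by (auto dest!: inj_onD[where x = "(x, y)" and y = "(z, w)"])
  then show ?thesis by simp
qed

text \<open>Stating the rule for \<open>f\<close> in \<open>int\<close> covers translations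
  (\<open>e = 1\<close>) and reflections (\<open>e = -1\<close>) alike, and confines truncated
  subtraction to the check that \<open>f\<close> is affine on the marks.\<close>

lemma golomb_ruler_image_affine:
  fixes e c :: int
  assumes "golomb_ruler A" and "e \<noteq> 0" and f: "\<And>x. x \<in> A \<Longrightarrow> int (f x) = e * int x + c"
  shows "golomb_ruler (f ` A)"
proof (rule golomb_rulerI)
  show "finite (f ` A)" using assms(1) by (simp add: golomb_ruler_def)
next
  fix x' y' z' w'
  assume in_image: "x' \<in> f ` A" "y' \<in> f ` A" "z' \<in> f ` A" "w' \<in> f ` A" and "x' \<noteq> y'"
    and eq: "int x' - int y' = int z' - int w'"
  from in_image obtain x y z w
    where A: "x \<in> A" "y \<in> A" "z \<in> A" "w \<in> A" and "x' = f x" "y' = f y" "z' = f z" "w' = f w"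
    by blast
  moreover have "e * (int x - int y) = e * (int z - int w)"
    using eq A f calculation by (simp add: algebra_simps)
  then have "int x - int y = int z - int w" using \<open>e \<noteq> 0\<close> by simp
  moreover have "x \<noteq> y" using \<open>x' \<noteq> y'\<close> calculation by blast
  ultimately show "x' = z' \<and> y' = w'" using golomb_rulerD[OF assms(1)] by blast
qed

text \<open>An image difference inside a block is at most \<open>D\<close> in absolute value, one
  across the blocks exceeds \<open>D\<close>, so the two kinds never coincide. Equal differences of
  the same kind carry the same shift, which cancels and leaves an equation in \<open>A\<close>. Only
  the images of the blocks have to be ordered, so the two blocks may also change places.\<close>

lemma golomb_ruler_image_piecewise:
  fixes c d D :: int
  assumes "golomb_ruler A"
    and P: "\<And>x. \<lbrakk>x \<in> A; P x\<rbrakk> \<Longrightarrow> int (f x) = int x + c"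
    and nP: "\<And>x. \<lbrakk>x \<in> A; \<not> P x\<rbrakk> \<Longrightarrow> int (f x) = int x + d"
    and within: "\<And>x y. \<lbrakk>x \<in> A; y \<in> A; P x \<longleftrightarrow> P y\<rbrakk> \<Longrightarrow> int y - int x \<le> D"
    and cross: "\<And>x y. \<lbrakk>x \<in> A; y \<in> A; P x; \<not> P y\<rbrakk> \<Longrightarrow> D < int (f y) - int (f x)"
  shows "golomb_ruler (f ` A)"
proof (rule golomb_rulerI)
  show "finite (f ` A)" using assms(1) by (simp add: golomb_ruler_def)
next
  fix x' y' z' w'
  assume in_image: "x' \<in> f ` A" "y' \<in> f ` A" "z' \<in> f ` A" "w' \<in> f ` A" and ne: "x' \<noteq> y'" "z' \<noteq> w'"
    and eq': "int x' - int y' = int z' - int w'"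
  from in_image obtain x y z w
    where A: "x \<in> A" "y \<in> A" "z \<in> A" "w \<in> A" and f: "x' = f x" "y' = f y" "z' = f z" "w' = f w"
    by blast
  have eq: "int (f x) - int (f y) = int (f z) - int (f w)" using eq' f by simp
  have D: "0 \<le> D" using within[OF A(1,1)] by simp
  have same: "int (f t) - int (f s) = int t - int s" "int t - int s \<le> D"
    if "s \<in> A" "t \<in> A" "P s \<longleftrightarrow> P t" for s t
    using P nP within that by (cases "P s"; simp)+
  have "(P x \<longleftrightarrow> P y) \<longleftrightarrow> (P z \<longleftrightarrow> P w)"
  proof (rule ccontr)
    assume contr: "\<not> ?thesis"
    \<comment> \<open>Here \<open>s\<close>, \<open>t\<close> share a block and \<open>u\<close>,
      \<open>v\<close> do not. Swapping the two sides of the equation, with both signs reversed,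
      reduces either mixed case to this one.\<close>
    have False if "s \<in> A" "t \<in> A" "u \<in> A" "v \<in> A" "P s \<longleftrightarrow> P t" "P u \<noteq> P v"
      "int (f t) - int (f s) = int (f u) - int (f v)" for s t u v
      using same[of s t] same[of t s] cross[of u v] cross[of v u] that by (cases "P u") auto
    from this[of y x z w] this[of w z x y] contr A eq show False by auto
  qed
  \<comment> \<open>Differences across the blocks are nonzero since \<open>D >= 0\<close>; equal
    ones have the same sign and hence run in the same direction.\<close>
  moreover have "P x \<longleftrightarrow> P z" if "P x \<noteq> P y" "P z \<noteq> P w"
    using that cross[of x y] cross[of y x] cross[of z w] cross[of w z] A eq D
    by (cases "P x"; cases "P z") auto
  ultimately have "int x - int y = int z - int w"
    using same[of x y] same[of z w] A eq P nP
    by (cases "P x"; cases "P y"; cases "P z"; cases "P w") auto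
  moreover have "x \<noteq> y" using ne f by blast
  ultimately show "x' = z' \<and> y' = w'" using golomb_rulerD[OF assms(1)] A f by blast
qed

section \<open>DGRs: counting marks, subfamilies, images, unions\<close>

lemma DGR_ruler:
  assumes "DGR I J n \<R>" "A \<in> \<R>"
  shows "golomb_ruler A" "A \<subseteq> {1..n}" "card A = J"
  using assms by (simp_all add: DGR_def)

lemma DGR_finite: "DGR I J n \<R> \<Longrightarrow> finite \<R>"
  and DGR_card: "DGR I J n \<R> \<Longrightarrow> card \<R> = I"
  unfolding DGR_def by blast+

lemma DGR_disjoint: "\<lbrakk>DGR I J n \<R>; A \<in> \<R>; B \<in> \<R>; A \<noteq> B\<rbrakk> \<Longrightarrow> A \<inter> B = {}"
  unfolding DGR_def by blast

lemma DGR_Union_subset: "DGR I J n \<R> \<Longrightarrow> \<Union>\<R> \<subseteq> {1..n}"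
  unfolding DGR_def by blast

lemma card_Union_DGR:
  assumes "DGR I J n \<R>"
  shows "card (\<Union>\<R>) = I * J"
proof -
  have "card (\<Union>\<R>) = sum card \<R>"
    using assms by (intro card_Union_disjoint) (auto simp: DGR_def disjnt_def pairwise_def golomb_ruler_def)
  also have "\<dots> = I * J" using assms by (simp add: DGR_def)
  finally show ?thesis .
qed

lemma DGR_subset:
  assumes R: "DGR I J n \<R>" and sub: "\<S> \<subseteq> \<R>" "\<Union>\<S> \<subseteq> {1..n'}"
  shows "DGR (card \<S>) J n' \<S>"
  unfolding DGR_def
proof (intro conjI ballI impI)
  show "finite \<S>" using DGR_finite[OF R] sub(1) by (rule rev_finite_subset)
  show "golomb_ruler A" "card A = J" if "A \<in> \<S>" for A
    using DGR_ruler[OF R, of A] sub(1) that by (simp_all add: subset_iff)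
  show "A \<subseteq> {1..n'}" if "A \<in> \<S>" for A
    using Union_upper[OF that] sub(2) by (rule subset_trans)
  show "A \<inter> B = {}" if "A \<in> \<S>" "B \<in> \<S>" "A \<noteq> B" for A B
    using DGR_disjoint[OF R, of A B] sub(1) that by (simp add: subset_iff)
qed (rule refl)

lemma H_le:
  assumes "DGR I J n \<R>" "0 < I" "0 < J"
  shows "H I J \<le> n"
proof -
  \<comment> \<open>\<open>H\<close> minimises over positive \<open>n\<close> only, and a DGR with
    \<open>I * J > 0\<close> marks does not fit into \<open>{1..0}\<close>.\<close>
  have "\<Union>\<R> \<noteq> {}" using card_Union_DGR[OF assms(1)] assms(2,3) by (metis card.empty mult_is_0 not_gr0)
  then have "0 < n" using DGR_Union_subset[OF assms(1)] by force
  then show ?thesis unfolding H_def using assms(1) by (intro Least_le) blast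
qed

text \<open>Injectivity on the whole union, not just on each ruler, is what keeps the image rulers
  distinct and disjoint.\<close>

lemma DGR_image:
  assumes "DGR I J n \<R>" and "inj_on f (\<Union>\<R>)" and "f ` \<Union>\<R> \<subseteq> {1..N}"
    and "\<And>A. A \<in> \<R> \<Longrightarrow> golomb_ruler (f ` A)"
  shows "DGR I J N ((`) f ` \<R>)"
proof -
  have inj: "inj_on f A" if "A \<in> \<R>" for A
    using assms(2) that by (auto intro: inj_on_subset)
  have "card ((`) f ` \<R>) = I"
    using assms(1,2) by (simp add: card_image inj_on_image DGR_def)
  moreover have "f ` A \<inter> f ` B = {}" if "A \<in> \<R>" "B \<in> \<R>" "f ` A \<noteq> f ` B" for A B
  proof -
    have "A \<inter> B = {}" using DGR_disjoint[OF assms(1)] that by blast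
    then show ?thesis using inj_on_image_Int[OF assms(2), of A B] that by blast
  qed
  moreover have "f ` A \<subseteq> {1..N}" if "A \<in> \<R>" for A using assms(3) that by blast
  ultimately show ?thesis
    using assms(1,4) inj unfolding DGR_def by (auto simp: card_image)
qed

lemma DGR_image_affine:
  fixes e c :: int
  assumes "DGR I J n \<R>" and "e \<noteq> 0" and f: "\<And>x. x \<in> \<Union>\<R> \<Longrightarrow> int (f x) = e * int x + c"
    and "f ` \<Union>\<R> \<subseteq> {1..N}"
  shows "DGR I J N ((`) f ` \<R>)"
proof (rule DGR_image[OF assms(1) _ assms(4)])
  show "inj_on f (\<Union>\<R>)"
  proof (rule inj_onI)
    fix x y assume "x \<in> \<Union>\<R>" "y \<in> \<Union>\<R>" "f x = f y"
    then have "e * int x = e * int y" using f by (metis add_right_cancel)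
    then show "x = y" using \<open>e \<noteq> 0\<close> by simp
  qed
  show "golomb_ruler (f ` A)" if "A \<in> \<R>" for A
    using assms(1,2) f that unfolding DGR_def by (intro golomb_ruler_image_affine[of A e f c]) auto
qed

text \<open>The bounds range over the union of all rulers, so they also yield injectivity: marks of
  different blocks have images more than \<open>D >= 0\<close> apart.\<close>

lemma DGR_image_piecewise:
  fixes c d D :: int
  assumes "DGR I J n \<R>"
    and P: "\<And>x. \<lbrakk>x \<in> \<Union>\<R>; P x\<rbrakk> \<Longrightarrow> int (f x) = int x + c"
    and nP: "\<And>x. \<lbrakk>x \<in> \<Union>\<R>; \<not> P x\<rbrakk> \<Longrightarrow> int (f x) = int x + d"
    and within: "\<And>x y. \<lbrakk>x \<in> \<Union>\<R>; y \<in> \<Union>\<R>; P x \<longleftrightarrow> P y\<rbrakk> \<Longrightarrow> int y - int x \<le> D"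
    and cross: "\<And>x y. \<lbrakk>x \<in> \<Union>\<R>; y \<in> \<Union>\<R>; P x; \<not> P y\<rbrakk> \<Longrightarrow> D < int (f y) - int (f x)"
    and "f ` \<Union>\<R> \<subseteq> {1..N}"
  shows "DGR I J N ((`) f ` \<R>)"
proof (rule DGR_image[OF assms(1) _ assms(6)])
  show "inj_on f (\<Union>\<R>)"
  proof (rule inj_onI)
    fix x y assume xy: "x \<in> \<Union>\<R>" "y \<in> \<Union>\<R>" "f x = f y"
    then have "P x \<longleftrightarrow> P y"
      using cross[of x y] cross[of y x] within[of x x] by auto
    then show "x = y" using xy P[of x] P[of y] nP[of x] nP[of y] by auto
  qed
  show "golomb_ruler (f ` A)" if A: "A \<in> \<R>" for A
  proof (rule golomb_ruler_image_piecewise[where P = P and c = c and d = d and D = D])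
    show "golomb_ruler A" using assms(1) A unfolding DGR_def by blast
  qed (use A in \<open>auto intro: P nP within cross\<close>)
qed

lemma DGR_Un:
  assumes R: "DGR I J n \<R>" and S: "DGR K J n \<S>" and "\<Union>\<R> \<inter> \<Union>\<S> = {}" "0 < J"
  shows "DGR (I + K) J n (\<R> \<union> \<S>)"
proof -
  have disj: "A \<inter> B = {}" if "A \<in> \<R>" "B \<in> \<S>" for A B
  proof -
    have "A \<inter> B \<subseteq> \<Union>\<R> \<inter> \<Union>\<S>" using that by (intro Int_mono Union_upper)
    then show ?thesis using assms(3) by simp
  qed
  \<comment> \<open>A ruler common to both families would be disjoint from itself, hence empty,
    against \<open>0 < J\<close>. So the cardinalities add.\<close>
  have "\<R> \<inter> \<S> = {}"
  proof (rule ccontr)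
    assume "\<R> \<inter> \<S> \<noteq> {}"
    then obtain A where A: "A \<in> \<R>" "A \<in> \<S>" by blast
    then have "A = {}" using disj[of A A] by simp
    then show False using DGR_ruler(3)[OF R A(1)] \<open>0 < J\<close> by simp
  qed
  then have "card (\<R> \<union> \<S>) = I + K"
    by (simp add: card_Un_disjoint DGR_finite[OF R] DGR_finite[OF S] DGR_card[OF R] DGR_card[OF S])
  moreover have "A \<inter> B = {}" if "A \<in> \<R> \<union> \<S>" "B \<in> \<R> \<union> \<S>" "A \<noteq> B" for A B
    using that disj[of A B] disj[of B A] DGR_disjoint[OF R, of A B] DGR_disjoint[OF S, of A B]
    by (auto simp only: Un_iff Int_commute)
  moreover have "golomb_ruler A \<and> A \<subseteq> {1..n} \<and> card A = J" if "A \<in> \<R> \<union> \<S>" for A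
    using DGR_ruler[OF R, of A] DGR_ruler[OF S, of A] that by (elim UnE) simp_all
  moreover have "finite (\<R> \<union> \<S>)" by (simp add: DGR_finite[OF R] DGR_finite[OF S])
  ultimately show ?thesis unfolding DGR_def by (intro conjI ballI impI) simp_all
qed

lemma DGR_reflect:
  assumes "DGR I J n \<R>"
  shows "DGR I J n ((`) (\<lambda>x. n + 1 - x) ` \<R>)"
  using DGR_Union_subset[OF assms]
  by (intro DGR_image_affine[OF assms, where e = "-1" and c = "int n + 1"]) force+

section \<open>The gap in an optimal DGR\<close>

lemma endpoints_in_Union_DGR_H:
  assumes R: "DGR I J (H I J) \<R>" and "0 < I" "0 < J"
  shows "1 \<in> \<Union>\<R>" "H I J \<in> \<Union>\<R>"
proof -
  let ?n = "H I J"
  have pos: "0 < ?n" using H_attained(1)[OF assms(2,3)] .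
  have sub: "\<Union>\<R> \<subseteq> {1..?n}" using DGR_Union_subset[OF R] .
  have no_smaller: "\<not> DGR I J (?n - 1) \<S>" for \<S>
    using H_le[of I J "?n - 1" \<S>] assms(2,3) pos by linarith
  have "DGR I J (?n - 1) \<R>" if "?n \<notin> \<Union>\<R>"
  proof -
    have "x \<in> {1..?n - 1}" if "x \<in> \<Union>\<R>" for x
    proof -
      have "x \<noteq> ?n" "1 \<le> x" "x \<le> ?n" using that sub \<open>?n \<notin> \<Union>\<R>\<close> by auto
      then show ?thesis by simp
    qed
    then show ?thesis using DGR_subset[OF R, of \<R> "?n - 1"] DGR_card[OF R] by (metis subsetI)
  qed
  then show "?n \<in> \<Union>\<R>" using no_smaller by blast
  \<comment> \<open>If 1 is free, shifting all marks down by one gives a DGR narrower than the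
    minimum.\<close>
  have "DGR I J (?n - 1) ((`) (\<lambda>x. x - 1) ` \<R>)" if "1 \<notin> \<Union>\<R>"
  proof -
    have ge2: "2 \<le> x \<and> x \<le> ?n" if "x \<in> \<Union>\<R>" for x
    proof -
      have "x \<noteq> 1" "1 \<le> x" "x \<le> ?n" using that sub \<open>1 \<notin> \<Union>\<R>\<close> by auto
      then show ?thesis by simp
    qed
    show ?thesis
      by (intro DGR_image_affine[OF R, where e = 1 and c = "-1"]) (use ge2 in fastforce)+
  qed
  then show "1 \<in> \<Union>\<R>" using no_smaller by blast
qed

text \<open>Pigeonhole: if each mark other than \<open>n\<close> were followed by a mark at distance
  at most \<open>g\<close>, the \<open>card U - 1\<close> windows of length \<open>g\<close> behind
  these marks would cover \<open>{2..n}\<close>, which has \<open>n - 1\<close> elements.\<close>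

lemma exists_gap:
  fixes U :: "nat set"
  assumes "U \<subseteq> {1..n}" "1 \<in> U" "n \<in> U" and less: "(card U - 1) * g < n - 1"
  obtains p where "p + g \<le> n" "U \<subseteq> {1..p} \<union> {p + g + 1..n}"
proof -
  have fin: "finite U" using assms(1) finite_subset by blast
  have "\<exists>p\<in>U - {n}. U \<inter> {p + 1..p + g} = {}"
  proof (rule ccontr)
    assume contr: "\<not> ?thesis"
    have "{2..n} \<subseteq> (\<Union>p\<in>U - {n}. {p + 1..p + g})"
    proof
      fix k assume k: "k \<in> {2..n}"
      \<comment> \<open>The nearest mark below \<open>k\<close>, which exists because 1 is a mark.
        By maximality the mark \<open>r\<close> in its window is at least \<open>k\<close>, so the
        window reaches \<open>k\<close>.\<close>
      define p where "p = Max (U \<inter> {..<k})"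
      have "p \<in> U \<inter> {..<k}"
        unfolding p_def using fin k assms(2) by (intro Max_in) auto
      then have p: "p \<in> U - {n}" "p < k" using k by auto
      then have "U \<inter> {p + 1..p + g} \<noteq> {}" using contr by blast
      then obtain r where "r \<in> U \<inter> {p + 1..p + g}" by blast
      then have r: "r \<in> U" "p < r" "r \<le> p + g" by auto
      have "\<not> r < k" using r(1,2) fin Max_ge[of "U \<inter> {..<k}" r] unfolding p_def by fastforce
      then show "k \<in> (\<Union>p\<in>U - {n}. {p + 1..p + g})" using p r by force
    qed
    then have "card {2..n} \<le> card (\<Union>p\<in>U - {n}. {p + 1..p + g})"
      using fin by (intro card_mono) auto
    also have "\<dots> \<le> (\<Sum>p\<in>U - {n}. card {p + 1..p + g})"
      using fin by (intro card_UN_le) auto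
    also have "\<dots> = (card U - 1) * g" using assms(3) fin by simp
    finally show False using less by simp
  qed
  then obtain p where p: "p \<in> U" "p \<noteq> n" and gap: "U \<inter> {p + 1..p + g} = {}" by blast
  have "p < n" using p assms(1) by fastforce
  \<comment> \<open>The window behind \<open>p\<close> is free of marks and \<open>n\<close> is a
    mark above \<open>p\<close>, so the window ends before \<open>n\<close>.\<close>
  then have "p + g \<le> n" using gap assms(3) by fastforce
  moreover have "U \<subseteq> {1..p} \<union> {p + g + 1..n}"
  proof
    fix x assume x: "x \<in> U"
    then have "x \<notin> {p + 1..p + g}" "x \<in> {1..n}" using gap assms(1) by blast+
    then show "x \<in> {1..p} \<union> {p + g + 1..n}" by auto
  qed
  ultimately show ?thesis using that by blast
qed

lemma DGR_H_gap:
  assumes "0 < a" "0 < J" "(a * J - 1) * g < H a J - 1"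
  obtains \<R> p q where "DGR a J (H a J) \<R>" "p + g + q = H a J" "p \<le> q"
    "\<Union>\<R> \<subseteq> {1..p} \<union> {p + g + 1..H a J}"
proof -
  let ?n = "H a J"
  obtain \<R> where R: "DGR a J ?n \<R>" using H_attained(2)[OF assms(1,2)] by blast
  have "(card (\<Union>\<R>) - 1) * g < ?n - 1" using card_Union_DGR[OF R] assms(3) by simp
  from exists_gap[OF DGR_Union_subset[OF R] endpoints_in_Union_DGR_H[OF R assms(1,2)] this]
  obtain p where p: "p + g \<le> ?n" and gap: "\<Union>\<R> \<subseteq> {1..p} \<union> {p + g + 1..?n}" .
  define q where "q = ?n - (p + g)"
  have pq: "p + g + q = ?n" using p by (simp add: q_def)
  show ?thesis
  proof (cases "p \<le> q")
    case True
    then show ?thesis using that R pq gap by blast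
  next
    case False
    have "(\<lambda>x. ?n + 1 - x) ` \<Union>\<R> \<subseteq> {1..q} \<union> {q + g + 1..?n}"
    proof (rule image_subsetI)
      fix x assume "x \<in> \<Union>\<R>"
      then have "x \<in> {1..p} \<union> {p + g + 1..?n}" using gap by blast
      then show "?n + 1 - x \<in> {1..q} \<union> {q + g + 1..?n}" using pq by auto
    qed
    then have "\<Union>((`) (\<lambda>x. ?n + 1 - x) ` \<R>) \<subseteq> {1..q} \<union> {q + g + 1..?n}"
      by (simp add: image_Union)
    then show ?thesis using that[OF DGR_reflect[OF R], of q p] pq False by simp
  qed
qed

section \<open>Upper bounds for \<open>H\<close> from a gap\<close>

lemma H_strict_mono:
  assumes "0 < a" "0 < b" "0 < J"
  shows "H a J < H (a + b) J"
proof -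
  let ?n = "H (a + b) J"
  obtain \<R> where R: "DGR (a + b) J ?n \<R>" using H_attained(2)[of "a + b" J] assms by auto
  obtain A where A: "A \<in> \<R>" "?n \<in> A"
    using endpoints_in_Union_DGR_H(2)[OF R] assms by auto
  have fin: "finite \<R>" and card: "card \<R> = a + b" using DGR_finite[OF R] DGR_card[OF R] .
  \<comment> \<open>\<open>A\<close> is the ruler holding the largest mark \<open>?n\<close>.
    Without it at least \<open>a\<close> rulers remain because \<open>b > 0\<close>, and by
    disjointness none of them contains \<open>?n\<close>.\<close>
  have "a \<le> card (\<R> - {A})" using A card fin assms(2) by (simp add: card_Diff_singleton)
  then obtain \<S> where S: "\<S> \<subseteq> \<R> - {A}" "card \<S> = a"
    using obtain_subset_with_card_n by metis
  have "\<Union>\<S> \<subseteq> {1..?n - 1}"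
  proof
    fix x assume "x \<in> \<Union>\<S>"
    then obtain B where B: "B \<in> \<R>" "B \<noteq> A" "x \<in> B" using S(1) by blast
    then have "B \<inter> A = {}" "x \<in> {1..?n}" using R A(1) unfolding DGR_def by blast+
    then have "x \<noteq> ?n" "1 \<le> x" "x \<le> ?n" using A(2) B(3) by auto
    then show "x \<in> {1..?n - 1}" by simp
  qed
  with R S have "DGR a J (?n - 1) \<S>" using DGR_subset[of "a + b" J ?n \<R> \<S> "?n - 1"] by auto
  then have "H a J \<le> ?n - 1" using H_le assms by blast
  then show ?thesis using H_attained(1)[of "a + b" J] assms by simp
qed

lemma H_le_of_disjoint_images:
  assumes "DGR a J N ((`) f ` \<A>)" "DGR b J N ((`) h ` \<B>)" "f ` \<Union>\<A> \<inter> h ` \<Union>\<B> = {}"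
    and "0 < a" "0 < J"
  shows "H (a + b) J \<le> N"
  using DGR_Un[OF assms(1,2)] assms(3-5) by (intro H_le) (auto simp: image_Union)

lemma H_add_le_of_gap:
  assumes pos: "0 < a" "0 < b" "0 < J"
    and A: "DGR a J (H a J) \<A>" and n: "p + g + q = H a J" and pq: "p \<le> q"
    and gap: "\<Union>\<A> \<subseteq> {1..p} \<union> {p + g + 1..H a J}"
  shows "H (a + b) J + g \<le> H a J + H b J"
proof -
  let ?n = "H a J" and ?m = "H b J"
  obtain \<B> where B: "DGR b J ?m \<B>" using H_attained(2)[OF pos(2,3)] by blast
  have xA: "1 \<le> x \<and> x \<le> p \<or> p + g < x \<and> x \<le> ?n" if "x \<in> \<Union>\<A>" for x
    using subsetD[OF gap that] by auto
  have xB: "1 \<le> x \<and> x \<le> ?m" if "x \<in> \<Union>\<B>" for x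
    using subsetD[OF DGR_Union_subset[OF B] that] by auto
  have A_id: "DGR a J N ((`) (\<lambda>x. x) ` \<A>)" if "?n \<le> N" for N
    using DGR_subset[OF A, of \<A> N] DGR_Union_subset[OF A] DGR_card[OF A] that by force
  have B_shift: "DGR b J N ((`) (\<lambda>x. x + p) ` \<B>)" if "p + ?m \<le> N" for N
    by (rule DGR_image_affine[OF B, where e = 1 and c = "int p"]) (use xB that in fastforce)+
  \<comment> \<open>Otherwise the DGR for \<open>b\<close> fits inside the gap and
    \<open>a + b\<close> rulers fit into \<open>{1..?n}\<close>, against strict monotonicity. The
    bound makes \<open>N\<close> exceed \<open>?n\<close> and the subtraction in the later
    \<open>f\<close> exact.\<close>
  have "g < ?m"
  proof (rule ccontr)
    assume "\<not> g < ?m"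
    then have "H (a + b) J \<le> ?n"
      using n xA xB pos by (intro H_le_of_disjoint_images[OF A_id B_shift]) fastforce+
    then show False using H_strict_mono[OF pos] by simp
  qed
  define N where "N = ?n + ?m - g"
  have N: "N + g = ?n + ?m" "N = p + ?m + q" using \<open>g < ?m\<close> n by (simp_all add: N_def)
  have "H (a + b) J \<le> N"
  proof (cases "q \<le> ?m")
    case True
    \<comment> \<open>The gap is widened from \<open>g\<close> to exactly \<open>?m\<close>, and
      \<open>\<B>\<close> fills it. Differences inside a block stay below \<open>q <= ?m\<close>,
      those across are at least \<open>?m + 1\<close>, so \<open>D = ?m\<close> works.\<close>
    define f where "f x = (if x \<le> p then x else x + ?m - g)" for x
    show ?thesis
    proof (rule H_le_of_disjoint_images)
      show "DGR a J N ((`) f ` \<A>)"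
      proof (rule DGR_image_piecewise[OF A, where P = "\<lambda>x. x \<le> p" and c = 0 and d = "int ?m - int g"
            and D = "int ?m"])
        show "f ` \<Union>\<A> \<subseteq> {1..N}"
          by (rule image_subsetI, drule xA) (use N n in \<open>auto simp: f_def\<close>)
      next
        fix x y assume "x \<in> \<Union>\<A>" "y \<in> \<Union>\<A>" "(x \<le> p) = (y \<le> p)"
        with xA[of x] xA[of y] pq True n show "int y - int x \<le> int ?m" by auto
      next
        fix x y assume "x \<in> \<Union>\<A>" "y \<in> \<Union>\<A>" "x \<le> p" "\<not> y \<le> p"
        with xA[of x] xA[of y] \<open>g < ?m\<close> show "int ?m < int (f y) - int (f x)" by (auto simp: f_def)
      qed (use \<open>g < ?m\<close> in \<open>auto simp: f_def\<close>)
      show "DGR b J N ((`) (\<lambda>x. x + p) ` \<B>)" using B_shift N by simp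
      have "f x \<noteq> y + p" if "x \<in> \<Union>\<A>" "y \<in> \<Union>\<B>" for x y
        using xA[OF that(1)] xB[OF that(2)] by (auto simp: f_def)
      then show "f ` \<Union>\<A> \<inter> (\<lambda>x. x + p) ` \<Union>\<B> = {}" by blast
    qed (use pos in auto)
  next
    case False
    \<comment> \<open>The top \<open>g\<close> numbers of \<open>{1..?m}\<close> go to the gap
      \<open>{p + 1..p + g}\<close>, the others to \<open>{?n + 1..N}\<close>. The upper block thus
      lands on the left; images across the blocks are at least \<open>q + 1 > ?m\<close>
      apart.\<close>
    define h where "h x = (if ?m < x + g then x + g + p - ?m else x + ?n)" for x
    show ?thesis
    proof (rule H_le_of_disjoint_images)
      show "DGR a J N ((`) (\<lambda>x. x) ` \<A>)" using A_id N \<open>g < ?m\<close> by simp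
      show "DGR b J N ((`) h ` \<B>)"
      proof (rule DGR_image_piecewise[OF B, where P = "\<lambda>x. ?m < x + g"
            and c = "int g + int p - int ?m" and d = "int ?n" and D = "int ?m"])
        show "h ` \<Union>\<B> \<subseteq> {1..N}"
        proof (rule image_subsetI)
          fix x assume "x \<in> \<Union>\<B>"
          then have "1 \<le> h x" "h x \<le> N" using xB[of x] N n \<open>g < ?m\<close> unfolding h_def by auto
          then show "h x \<in> {1..N}" by simp
        qed
      next
        fix x y assume "x \<in> \<Union>\<B>" "y \<in> \<Union>\<B>"
        with xB[of x] xB[of y] show "int y - int x \<le> int ?m" by auto
      next
        fix x y assume "x \<in> \<Union>\<B>" "y \<in> \<Union>\<B>" "?m < x + g" "\<not> ?m < y + g"
        with xB[of x] xB[of y] False n show "int ?m < int (h y) - int (h x)" by (auto simp: h_def)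
      qed (auto simp: h_def)
      have "x \<noteq> h y" if "x \<in> \<Union>\<A>" "y \<in> \<Union>\<B>" for x y
        using xA[OF that(1)] xB[OF that(2)] n by (auto simp: h_def)
      then show "(\<lambda>x. x) ` \<Union>\<A> \<inter> h ` \<Union>\<B> = {}" by blast
    qed (use pos in auto)
  qed
  then show ?thesis using N by simp
qed

lemma H_double_le_of_gap:
  assumes pos: "0 < a" "0 < J"
    and A: "DGR a J (H a J) \<A>" and n: "p + g + q = H a J" and pq: "p \<le> q"
    and gap: "\<Union>\<A> \<subseteq> {1..p} \<union> {p + g + 1..H a J}"
  shows "H (2 * a) J + 2 * g \<le> 2 * H a J"
proof -
  let ?n = "H a J"
  \<comment> \<open>This is \<open>2 * (?n - g)\<close>, the total width of four adjacent
    blocks.\<close>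
  define N where "N = 2 * (p + q)"
  have xA: "1 \<le> x \<and> x \<le> p \<or> p + g < x \<and> x \<le> ?n" if "x \<in> \<Union>\<A>" for x
    using subsetD[OF gap that] by auto
  define \<B> where "\<B> = (`) (\<lambda>x. ?n + 1 - x) ` \<A>"
  have B: "DGR a J ?n \<B>" unfolding \<B>_def by (rule DGR_reflect[OF A])
  have xB: "1 \<le> x \<and> x \<le> q \<or> q + g < x \<and> x \<le> ?n" if x: "x \<in> \<Union>\<B>" for x
  proof -
    obtain y where "y \<in> \<Union>\<A>" "x = ?n + 1 - y" using x unfolding \<B>_def by blast
    with xA[of y] n show ?thesis by auto
  qed
  \<comment> \<open>The blocks of \<open>\<A>\<close> go to \<open>{1..p}\<close> and
    \<open>{p + q + 1..p + 2 * q}\<close>, those of the mirrored copy under \<open>h\<close> to the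
    intervals of widths \<open>q\<close> and \<open>p\<close> following them. Each copy then has a
    gap of width \<open>q\<close>, so its differences across are at least \<open>q + 1\<close>,
    while those inside a block stay below \<open>q\<close>.\<close>
  define f where "f x = (if x \<le> p then x else x + q - g)" for x
  define h where "h x = (if x \<le> q then x + p else x + p + q - g)" for x
  have "H (a + a) J \<le> N"
  proof (rule H_le_of_disjoint_images)
    show "DGR a J N ((`) f ` \<A>)"
    proof (rule DGR_image_piecewise[OF A, where P = "\<lambda>x. x \<le> p" and c = 0 and d = "int q - int g"
          and D = "int q"])
      show "f ` \<Union>\<A> \<subseteq> {1..N}"
        by (rule image_subsetI, drule xA) (use N_def n in \<open>auto simp: f_def\<close>)
    next
      fix x y assume "x \<in> \<Union>\<A>" "y \<in> \<Union>\<A>" "(x \<le> p) = (y \<le> p)"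
      with xA[of x] xA[of y] pq n show "int y - int x \<le> int q" by auto
    next
      fix x assume "x \<in> \<Union>\<A>" "\<not> x \<le> p"
      with xA[of x] show "int (f x) = int x + (int q - int g)" by (auto simp: f_def)
    next
      fix x y assume "x \<in> \<Union>\<A>" "y \<in> \<Union>\<A>" "x \<le> p" "\<not> y \<le> p"
      with xA[of x] xA[of y] show "int q < int (f y) - int (f x)" by (auto simp: f_def)
    qed (auto simp: f_def)
    show "DGR a J N ((`) h ` \<B>)"
    proof (rule DGR_image_piecewise[OF B, where P = "\<lambda>x. x \<le> q" and c = "int p"
          and d = "int p + int q - int g" and D = "int q"])
      show "h ` \<Union>\<B> \<subseteq> {1..N}"
        by (rule image_subsetI, drule xB) (use N_def n in \<open>auto simp: h_def\<close>)
    next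
      fix x y assume "x \<in> \<Union>\<B>" "y \<in> \<Union>\<B>" "(x \<le> q) = (y \<le> q)"
      with xB[of x] xB[of y] pq n show "int y - int x \<le> int q" by auto
    next
      fix x assume "x \<in> \<Union>\<B>" "\<not> x \<le> q"
      with xB[of x] show "int (h x) = int x + (int p + int q - int g)" by (auto simp: h_def)
    next
      fix x y assume "x \<in> \<Union>\<B>" "y \<in> \<Union>\<B>" "x \<le> q" "\<not> y \<le> q"
      with xB[of x] xB[of y] show "int q < int (h y) - int (h x)" by (auto simp: h_def)
    qed (auto simp: h_def)
    have "f x \<noteq> h y" if "x \<in> \<Union>\<A>" "y \<in> \<Union>\<B>" for x y
      using xA[OF that(1)] xB[OF that(2)] n by (auto simp: f_def h_def)
    then show "f ` \<Union>\<A> \<inter> h ` \<Union>\<B> = {}" by blast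
  qed (use pos in auto)
  then show ?thesis using n by (simp add: N_def mult_2)
qed

section \<open>The gap length as a ceiling\<close>

theorem theorem6:
  fixes a b J :: nat
  assumes "a > 0" and "b > 0" and "J \<ge> 3"
    and "H a J \<ge> a * J + 1"
  shows "int (H (a + b) J) \<le> int (H a J) + int (H b J)
           - \<lceil>(real (H a J) - real (a * J)) / (real (a * J) - 1)\<rceil>
       \<and> int (H (2 * a) J) \<le> 2 * int (H a J)
           - 2 * \<lceil>(real (H a J) - real (a * J)) / (real (a * J) - 1)\<rceil>"
proof -
  let ?r = "(real (H a J) - real (a * J)) / (real (a * J) - 1)"
  define g where "g = nat \<lceil>?r\<rceil>"
  have "1 * 3 \<le> a * J" using assms(1,3) by (intro mult_le_mono) auto
  then have aJ: "3 \<le> a * J" by simp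
  then have aJ_real: "3 \<le> real (a * J)" by linarith
  \<comment> \<open>Positivity makes the conversion by \<open>nat\<close> in \<open>g\<close>
    lossless.\<close>
  have "0 < ?r" using assms(4) aJ_real by (intro divide_pos_pos) linarith+
  then have ceil: "\<lceil>?r\<rceil> = int g" unfolding g_def by simp
  \<comment> \<open>Clearing the denominator in this ceiling bound gives
    \<open>(a * J - 1) * g < H a J - 1\<close>, the pigeonhole condition for \<open>a * J\<close>
    marks with \<open>a * J - 1\<close> spaces between them.\<close>
  have "real g - 1 < ?r" using ceil by linarith
  then have "(real g - 1) * (real (a * J) - 1) < real (H a J) - real (a * J)"
    using aJ_real by (subst (asm) pos_less_divide_eq) linarith+
  then have "(real (a * J) - 1) * real g < real (H a J) - 1" by (simp add: algebra_simps)
  then have "real ((a * J - 1) * g) < real (H a J - 1)"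
    using aJ assms(4) by (simp only: of_nat_mult of_nat_diff) simp
  then have "(a * J - 1) * g < H a J - 1" by (simp only: of_nat_less_iff)
  moreover have "0 < J" using assms(3) by simp
  ultimately obtain \<R> p q where gap: "DGR a J (H a J) \<R>" "p + g + q = H a J" "p \<le> q"
    "\<Union>\<R> \<subseteq> {1..p} \<union> {p + g + 1..H a J}"
    using DGR_H_gap[OF assms(1)] by metis
  have "H (a + b) J + g \<le> H a J + H b J"
    using H_add_le_of_gap[OF assms(1,2) \<open>0 < J\<close> gap] .
  moreover have "H (2 * a) J + 2 * g \<le> 2 * H a J"
    using H_double_le_of_gap[OF assms(1) \<open>0 < J\<close> gap] .
  ultimately show ?thesis unfolding ceil by linarith
qed

end
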